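(* Let $\rho$ be a Minkowski norm on $\mathbb{R}^d$ whose unit ball is a polytope $P$ with $k$ facets, and let $K \subset \mathbb{R}^d$ be compact. Suppose that for any $kd$ points in $K$ there is a line segment of $\rho$-length at least $1$ such that every point on the segment sees all $kd$ points. Then there is a line segment of $\rho$-length at least $1$ such that every point on the segment sees all of $K$.
   Context: For $K \subset \mathbb{R}^d$ and $x,y \in K$, $x$ sees $y$ if the closed segment $[x,y]$ is contained in $K$. Given a compact convex set $P \subset \mathbb{R}^d$ with nonempty interior, symmetric about the origin, its Minkowski norm is $\rho(x) = \min\{t \ge 0 : x \in tP\}$. The $\rho$-length of a segment $[a,b]$ is $\rho(b-a)$ (called its $\rho$-norm in the paper). *)

theory Defs
  imports "HOL-Analysis.Analysis"
begin

text \<open>Since \<^term>\<open>closed_segment x y\<close> contains both endpoints, \<^term>\<open>x \<in> K\<close> and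
  \<^term>\<open>y \<in> K\<close> are part of the condition.\<close>

definition sees :: "'a::euclidean_space set \<Rightarrow> 'a \<Rightarrow> 'a \<Rightarrow> bool" where
  "sees K x y \<longleftrightarrow> closed_segment x y \<subseteq> K"

definition minkowski_norm :: "'a::euclidean_space set \<Rightarrow> 'a \<Rightarrow> real" where
  "minkowski_norm P x = (LEAST t. 0 \<le> t \<and> x \<in> (\<lambda>p. t *\<^sub>R p) ` P)"

text \<open>\<^const>\<open>Least\<close> is only meaningful if the minimum exists; it does for the sets of interest.\<close>

lemma minkowski_norm_is_min:
  fixes P :: "'a::euclidean_space set"
  assumes P: "compact P" "convex P" "interior P \<noteq> {}" "\<forall>x\<in>P. - x \<in> P"
  shows "0 \<le> minkowski_norm P x" "x \<in> (\<lambda>p. minkowski_norm P x *\<^sub>R p) ` P"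
    and "\<And>t. 0 \<le> t \<Longrightarrow> x \<in> (\<lambda>p. t *\<^sub>R p) ` P \<Longrightarrow> minkowski_norm P x \<le> t"
proof -
  let ?T = "\<lambda>t. 0 \<le> t \<and> x \<in> (\<lambda>p. t *\<^sub>R p) ` P"
  obtain c e where e: "e > 0" "ball c e \<subseteq> P"
    using P(3) by (meson ex_in_conv mem_interior)
  have ball0: "y \<in> P" if "norm y < e" for y
  proof -
    have "c + y \<in> P" "c - y \<in> P"
      using e(2) that by (auto simp: dist_norm subset_iff)
    then have "c + y \<in> P" "- (c - y) \<in> P"
      using P(4) by auto
    then have "(1/2) *\<^sub>R (c + y) + (1/2) *\<^sub>R (- (c - y)) \<in> P"
      by (intro convexD[OF P(2)]) auto
    moreover have "(1/2) *\<^sub>R (c + y) + (1/2) *\<^sub>R (- (c - y)) = y"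
      by (simp add: algebra_simps flip: scaleR_add_left)
    ultimately show ?thesis
      by simp
  qed
  define s where "s = (norm x + 1) / e"
  have s: "0 < s"
    using e(1) by (simp add: s_def add_nonneg_pos)
  have "norm (x /\<^sub>R s) < e"
    using s e(1) by (simp add: s_def divide_simps mult.commute)
  then have "?T s"
    using s ball0[of "x /\<^sub>R s"] by (auto intro!: image_eqI[where x = "x /\<^sub>R s"])
  define A where "A = {z \<in> {0..s} \<times> P. fst z *\<^sub>R snd z = x}"
  have A: "A = ({0..s} \<times> P) \<inter> (\<lambda>z. fst z *\<^sub>R snd z) -` {x}"
    by (auto simp: A_def)
  have "compact ({0..s} \<times> P)"
    by (intro compact_Times compact_Icc P(1))
  moreover have "closed ((\<lambda>z::real \<times> 'a. fst z *\<^sub>R snd z) -` {x})"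
    by (intro closed_vimage closed_singleton continuous_intros)
  ultimately have "compact (fst ` A)"
    unfolding A by (intro compact_continuous_image compact_Int_closed continuous_intros)
  moreover have "fst ` A = {t. t \<le> s \<and> ?T t}"
    by (force simp: A_def)
  moreover have "{t. t \<le> s \<and> ?T t} \<noteq> {}"
    using \<open>?T s\<close> by blast
  ultimately obtain m where m: "?T m" "m \<le> s" "\<And>t. t \<le> s \<Longrightarrow> ?T t \<Longrightarrow> m \<le> t"
    using compact_attains_inf[of "fst ` A"] by auto
  have min: "m \<le> t" if "?T t" for t
    using m that by (cases "t \<le> s") auto
  have eq: "minkowski_norm P x = m"
    unfolding minkowski_norm_def by (rule Least_equality) (use m(1) min in auto)
  show "0 \<le> minkowski_norm P x" "x \<in> (\<lambda>p. minkowski_norm P x *\<^sub>R p) ` P"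
    and "\<And>t. 0 \<le> t \<Longrightarrow> x \<in> (\<lambda>p. t *\<^sub>R p) ` P \<Longrightarrow> minkowski_norm P x \<le> t"
    using m(1) min unfolding eq by auto
qed

end

theory Submission
  imports Defs
begin

text \<open>
  The hull \<open>convex hull {z. sees K z x}\<close> replaces the non-convex visibility region of \<open>x\<close>:
  Krasnosel'skii's argument shows that a point in all these hulls sees the whole of \<open>K\<close>. So it
  suffices to find a long segment in the intersection of the hulls, which is a question about convex
  sets. A vector \<open>v\<close> has \<open>\<rho>\<close>-length at least 1 iff \<open>u \<bullet> v \<ge> 1\<close> for the outer normal \<open>u\<close> of some
  facet of \<open>P\<close>, suitably scaled, and up to the sign of \<open>v\<close> half of the facets are enough. For a fixed
  \<open>u\<close> the segments \<open>[a, b]\<close> with \<open>u \<bullet> (b - a) = 1\<close> inside a convex set \<open>C\<close> form the convex set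
  \<open>(C \<times> C) \<inter> H\<close> with \<open>H\<close> a hyperplane of dimension \<open>2d - 1\<close>, so Helly's number for them is \<open>2d\<close>.
  If every one of the at most \<open>k/2\<close> normals failed, the union of the witnessing subfamilies would
  consist of at most \<open>(k/2) (2d) = kd\<close> points violating the hypothesis.
\<close>

section \<open>Krasnosel'skii's argument\<close>

text \<open>Compactness of these regions, and hence of their hulls, lets Helly's theorem reach the
  possibly infinite family indexed by \<open>K\<close>.\<close>

lemma compact_sees:
  assumes "compact K"
  shows "compact {z. sees K z x}"
proof -
  have eq: "{z. sees K z x} = (\<Inter>t\<in>{0..1}. (\<lambda>z. (1 - t) *\<^sub>R z + t *\<^sub>R x) -` K)"
    by (auto simp: sees_def closed_segment_image_interval image_subset_iff)
  have "closed {z. sees K z x}"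
    unfolding eq
    by (intro closed_INT ballI closed_vimage compact_imp_closed assms continuous_intros)
  moreover have "{z. sees K z x} \<subseteq> K"
    by (auto simp: sees_def)
  ultimately show ?thesis
    using assms by (metis compact_Int_closed inf.absorb2)
qed

text \<open>On the segment from a point that sees \<open>x\<close> to \<open>x\<close>, the point
  nearest to \<open>v\<close> is \<open>x\<close> itself, which bounds the inner product.
  Half-spaces being convex, the bound passes to the hull.\<close>

lemma hull_sees_halfspace:
  assumes K: "x \<in> K" and closest: "\<And>p. p \<in> K \<Longrightarrow> dist v x \<le> dist v p"
    and y: "y \<in> convex hull {z. sees K z x}"
  shows "(v - x) \<bullet> (y - x) \<le> 0"
proof -
  have "(v - x) \<bullet> (p - x) \<le> 0" if "sees K p x" for p
    using that closest
    by (intro any_closest_point_dot[where S = "closed_segment p x"]) (auto simp: sees_def)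
  then have "{z. sees K z x} \<subseteq> {p. (v - x) \<bullet> p \<le> (v - x) \<bullet> x}"
    by (auto simp: inner_diff_right)
  then have "convex hull {z. sees K z x} \<subseteq> {p. (v - x) \<bullet> p \<le> (v - x) \<bullet> x}"
    by (rule hull_minimal) (rule convex_halfspace_le)
  with y show ?thesis
    by (auto simp: inner_diff_right)
qed

text \<open>Walking from \<open>x1 \<in> K\<close> towards \<open>z \<notin> K\<close>, one starts closer to \<open>K\<close> than one ends, so the
  point of the walk closest to \<open>K\<close> is not \<open>z\<close> and still looks away from \<open>K\<close> in the direction of
  \<open>z\<close>.\<close>

lemma obtain_receding_point:
  fixes K :: "'a::euclidean_space set"
  assumes K: "compact K" and x: "x \<in> K" and z: "z \<notin> K"
  obtains v w r where "w \<in> K" "\<And>p. p \<in> K \<Longrightarrow> dist v w \<le> dist v p" "v \<noteq> w"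
    "(w - v) \<bullet> (z - v) \<le> 0" "0 < r" "z - v = r *\<^sub>R (z - x)"
proof -
  have "closed (closed_segment x z \<inter> K)"
    using K by (simp add: closed_Int compact_imp_closed)
  \<comment> \<open>\<open>x1\<close> is the last point of \<open>K\<close> on the way from
    \<open>x\<close> to \<open>z\<close>.\<close>
  then obtain x1 where x1: "x1 \<in> closed_segment x z" "x1 \<in> K"
      and x1_min: "\<And>q. q \<in> closed_segment x z \<Longrightarrow> q \<in> K \<Longrightarrow> dist z x1 \<le> dist z q"
    by (rule distance_attains_inf[where a = z]) (use x in auto)
  define D where "D = setdist {z} K"
  have D_le: "D \<le> dist z p" if "p \<in> K" for p
    using that by (simp add: D_def setdist_le_dist)
  have "D > 0"
    using z x K by (simp add: D_def setdist_gt_0_compact_closed compact_imp_closed) auto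
  have n: "norm (z - x1) \<ge> D"
    using D_le[OF x1(2)] by (simp add: dist_norm)
  \<comment> \<open>With this \<open>e\<close>, \<open>x'\<close> lies past \<open>x1\<close> at
    distance \<open>D / 2\<close> from it, so it is closer to \<open>K\<close> than \<open>z\<close>
    is. Hence a point \<open>v\<close> of \<open>T\<close> nearest to \<open>K\<close> differs from
    \<open>z\<close>.\<close>
  define e where "e = D / (2 * norm (z - x1))"
  have e: "0 < e" "e < 1" "e * norm (z - x1) < D"
    using n \<open>D > 0\<close> less_le_trans[OF \<open>D > 0\<close> n] by (simp_all add: e_def divide_simps)
  define x' where "x' = x1 + e *\<^sub>R (z - x1)"
  define T where "T = closed_segment x' z"
  have x'T: "x' \<in> T"
    by (simp add: T_def)
  have x'_seg: "x' \<in> closed_segment x1 z"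
    using e by (auto simp: x'_def closed_segment_def algebra_simps intro!: exI[of _ e])
  have T1: "T \<subseteq> closed_segment x1 z"
    using x'_seg by (simp add: T_def subset_closed_segment)
  have T2: "T \<subseteq> closed_segment x z"
    using T1 x1(1) subset_closed_segment[of x1 z x z] by auto
  have T3: "q \<notin> K" if "q \<in> T" for q
  proof
    assume "q \<in> K"
    then have "dist z x1 \<le> dist z q"
      using x1_min that T2 by blast
    also have "\<dots> \<le> dist z x'"
      using that dist_in_closed_segment[of q x' z] by (simp add: T_def dist_commute)
    also have "z - x' = (1 - e) *\<^sub>R (z - x1)"
      by (simp add: x'_def algebra_simps)
    then have "dist z x' = (1 - e) * norm (z - x1)"
      using e by (simp add: dist_norm)
    also have "\<dots> < dist z x1"
      using mult_pos_pos[OF e(1) less_le_trans[OF \<open>D > 0\<close> n]]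
      by (simp add: dist_norm left_diff_distrib)
    finally show False by simp
  qed
  obtain v w where vw: "v \<in> T" "w \<in> K" "dist v w = setdist T K"
    using setdist_compact_closed[of T K] K x x'T by (auto simp: T_def compact_imp_closed)
  have v_min: "dist v w \<le> dist p q" if "p \<in> T" "q \<in> K" for p q
    using that by (simp add: vw(3) setdist_le_dist)
  have "dist v w \<le> dist x' x1"
    using v_min x'T x1(2) by blast
  also have "\<dots> = e * norm (z - x1)"
    using e by (simp add: x'_def dist_norm)
  also have "\<dots> < D"
    by (rule e)
  finally have "v \<noteq> z"
    using D_le[OF vw(2)] by auto
  obtain s where s: "s \<le> 1" "v = (1 - s) *\<^sub>R x + s *\<^sub>R z"
    using T2 vw(1) by (auto simp: closed_segment_def)
  with \<open>v \<noteq> z\<close> have "s < 1"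
    by (cases "s = 1") auto
  moreover have "z - v = (1 - s) *\<^sub>R (z - x)"
    by (simp add: s(2) algebra_simps)
  moreover have "(w - v) \<bullet> (z - v) \<le> 0"
    using vw v_min by (intro any_closest_point_dot[of T]) (auto simp: T_def dist_commute)
  moreover have "v \<noteq> w"
    using T3 vw by blast
  ultimately show ?thesis
    using that[of w v "1 - s"] vw v_min by auto
qed

text \<open>A point outside \<open>K\<close> between \<open>x\<close> and \<open>y\<close> would
  yield a triangle \<open>v\<close>, \<open>w\<close>, \<open>y\<close> with non-acute angles at
  both \<open>v\<close> (receding point) and \<open>w\<close> (half-space bound), impossible for
  \<open>v\<close> different from \<open>w\<close>.\<close>

lemma sees_if_in_all_hulls:
  fixes K :: "'a::euclidean_space set"
  assumes K: "compact K" and x: "x \<in> K"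
    and y: "\<And>w. w \<in> K \<Longrightarrow> y \<in> convex hull {z. sees K z w}"
  shows "sees K y x"
proof (rule ccontr)
  assume "\<not> sees K y x"
  then obtain z where z: "z \<in> closed_segment x y" "z \<notin> K"
    by (auto simp: sees_def closed_segment_commute)
  obtain v w r where w: "w \<in> K" "\<And>p. p \<in> K \<Longrightarrow> dist v w \<le> dist v p" "v \<noteq> w"
    "(w - v) \<bullet> (z - v) \<le> 0" and r: "0 < r" "z - v = r *\<^sub>R (z - x)"
    by (rule obtain_receding_point[OF K x z(2)]) (rule that)
  obtain t where t: "0 \<le> t" "t \<le> 1" "z = (1 - t) *\<^sub>R x + t *\<^sub>R y"
    using z(1) by (auto simp: closed_segment_def)
  have "t \<noteq> 0"
    using t x z(2) by auto
  have zx: "z - x = t *\<^sub>R (y - x)" and yz: "y - z = (1 - t) *\<^sub>R (y - x)"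
    by (auto simp: t(3) algebra_simps)
  \<comment> \<open>\<open>z - v\<close>, \<open>y - x\<close> and \<open>y - z\<close> are
    nonnegative multiples of one vector, so the sign carries over and \<open>z\<close> can be
    replaced by \<open>y\<close>.\<close>
  have "(w - v) \<bullet> (y - x) \<le> 0"
    using w(4) \<open>t \<noteq> 0\<close> t(1) r by (simp add: zx mult_le_0_iff)
  then have "(w - v) \<bullet> (y - z) \<le> 0"
    using t(2) unfolding yz by (simp add: mult_le_0_iff)
  with w(4) have 1: "(w - v) \<bullet> (y - v) \<le> 0"
    by (simp add: inner_diff_right)
  have 2: "(v - w) \<bullet> (y - w) \<le> 0"
    using hull_sees_halfspace[OF w(1,2) y[OF w(1)]] .
  have "(v - w) \<bullet> (v - w) = (v - w) \<bullet> (y - w) + (w - v) \<bullet> (y - v)"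
    by (simp add: inner_diff_left inner_diff_right)
  with 1 2 have "\<not> 0 < (v - w) \<bullet> (v - w)"
    by linarith
  then show False
    using w(3) by simp
qed

section \<open>Helly's theorem for segments of given width\<close>

text \<open>Leaving out each member in turn gives more than \<open>n\<close> points of
  \<open>S\<close>, affinely dependent because of the dimension of \<open>S\<close>; a Radon point
  of them is common to all members. Thus \<open>S\<close>, not the ambient space, determines the
  Helly number.\<close>

lemma Helly_aff_dim:
  fixes C :: "'i \<Rightarrow> 'a::euclidean_space set" and n :: nat
  assumes "finite I" and "\<And>i. i \<in> I \<Longrightarrow> convex (C i)" and "\<And>i. i \<in> I \<Longrightarrow> C i \<subseteq> S"
    and "aff_dim S < int n"
    and "\<And>J. J \<subseteq> I \<Longrightarrow> card J \<le> n \<Longrightarrow> S \<inter> (\<Inter>i\<in>J. C i) \<noteq> {}"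
  shows "S \<inter> (\<Inter>i\<in>I. C i) \<noteq> {}"
  using assms
proof (induction I rule: finite_psubset_induct)
  case (psubset I)
  note cvx = psubset.prems(1) and CS = psubset.prems(2) and dimS = psubset.prems(3)
    and sub = psubset.prems(4)
  show ?case
  proof (cases "card I \<le> n")
    case True
    then show ?thesis using sub by blast
  next
    case False
    then have "I \<noteq> {}" by auto
    have "\<exists>p. p \<in> S \<inter> (\<Inter>j\<in>I - {i}. C j)" if "i \<in> I" for i
    proof -
      have "S \<inter> (\<Inter>j\<in>I - {i}. C j) \<noteq> {}"
      proof (rule psubset.IH)
        show "I - {i} \<subset> I" using that by blast
        show "S \<inter> (\<Inter>j\<in>J. C j) \<noteq> {}" if "J \<subseteq> I - {i}" "card J \<le> n" for J
          using that by (intro sub) auto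
      qed (use cvx CS dimS in auto)
      then show ?thesis by blast
    qed
    then obtain p where p: "\<And>i. i \<in> I \<Longrightarrow> p i \<in> S"
        "\<And>i j. i \<in> I \<Longrightarrow> j \<in> I \<Longrightarrow> j \<noteq> i \<Longrightarrow> p i \<in> C j"
      by (metis (no_types, lifting) DiffI INT_E IntD1 IntD2 singletonD)
    show ?thesis
    proof (cases "inj_on p I")
      case False
      then obtain i j where ij: "i \<in> I" "j \<in> I" "i \<noteq> j" "p i = p j"
        by (auto simp: inj_on_def)
      \<comment> \<open>Only \<open>C i\<close> is in doubt for \<open>p i\<close>, and
        \<open>p j\<close>, the same point, lies in it.\<close>
      have "p i \<in> C l" if "l \<in> I" for l
        using p(2)[of i l] p(2)[of j l] ij that by metis
      then show ?thesis using p(1) ij(1) by blast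
    next
      case True
      have "affine_dependent (p ` I)"
      proof (rule ccontr)
        assume "\<not> affine_dependent (p ` I)"
        then have "aff_dim (p ` I) = int (card I) - 1"
          using True by (simp add: affine_independent_iff_card card_image)
        moreover have "aff_dim (p ` I) \<le> aff_dim S"
          using p(1) by (intro aff_dim_subset) auto
        ultimately show False
          using dimS \<open>\<not> card I \<le> n\<close> by linarith
      qed
      then obtain M N where MN: "M \<subseteq> p ` I" "N \<subseteq> p ` I" "M \<inter> N = {}"
          "convex hull M \<inter> convex hull N \<noteq> {}"
        by (rule Radon)
      then obtain q where q: "q \<in> convex hull M" "q \<in> convex hull N"
        by blast
      have "q \<in> C i" if i: "i \<in> I" for i
      proof -
        \<comment> \<open>All chosen points other than \<open>p i\<close> lie in \<open>C i\<close>,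
          so the side of the Radon partition that omits \<open>p i\<close> has its hull
          there.\<close>
        have *: "convex hull L \<subseteq> C i" if "L \<subseteq> p ` I" "p i \<notin> L" for L
          using that p(2)[of _ i] i by (intro hull_minimal cvx) auto
        have "p i \<notin> M \<or> p i \<notin> N" using MN(3) by blast
        then show ?thesis using * MN(1,2) q by blast
      qed
      then show ?thesis using \<open>I \<noteq> {}\<close> CS by blast
    qed
  qed
qed

text \<open>Segments become points \<open>(a, b)\<close> of the product space. Working inside the
  hyperplane \<open>H\<close> lowers the Helly number from 2d + 1 to 2d.\<close>

lemma Helly_width:
  fixes C :: "'i \<Rightarrow> 'a::euclidean_space set"
  assumes u: "u \<noteq> 0"
    and C: "\<And>i. i \<in> I \<Longrightarrow> compact (C i)" "\<And>i. i \<in> I \<Longrightarrow> convex (C i)"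
    and sub: "\<And>J. J \<subseteq> I \<Longrightarrow> finite J \<Longrightarrow> card J \<le> 2 * DIM('a) \<Longrightarrow>
      \<exists>a b. (\<forall>i\<in>J. a \<in> C i \<and> b \<in> C i) \<and> u \<bullet> (b - a) = 1"
  shows "\<exists>a b. (\<forall>i\<in>I. a \<in> C i \<and> b \<in> C i) \<and> u \<bullet> (b - a) = 1"
proof -
  define H :: "('a \<times> 'a) set" where "H = {w. (- u, u) \<bullet> w = 1}"
  have H_iff: "(a, b) \<in> H \<longleftrightarrow> u \<bullet> (b - a) = 1" for a b
    by (auto simp: H_def inner_diff_right)
  have "aff_dim H = int (DIM('a \<times> 'a) - 1)"
    unfolding H_def using u by (intro aff_dim_hyperplane) (simp add: zero_prod_def)
  then have dimH: "aff_dim H < int (2 * DIM('a))"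
    using DIM_positive[where 'a='a] by simp
  define D where "D = (\<lambda>i. H \<inter> C i \<times> C i)"
  have "convex H" "closed H"
    unfolding H_def by (auto intro: convex_hyperplane closed_hyperplane)
  then have D: "compact (D i)" "convex (D i)" if "i \<in> I" for i
    using C that by (auto simp: D_def compact_Times closed_Int_compact convex_Int convex_Times)
  have fin: "H \<inter> (\<Inter>i\<in>J. D i) \<noteq> {}" if J: "finite J" "J \<subseteq> I" for J
  proof (rule Helly_aff_dim[OF J(1) _ _ dimH])
    show "H \<inter> (\<Inter>i\<in>L. D i) \<noteq> {}" if L: "L \<subseteq> J" "card L \<le> 2 * DIM('a)" for L
    proof -
      obtain a b where "\<forall>i\<in>L. a \<in> C i \<and> b \<in> C i" "u \<bullet> (b - a) = 1"
        using sub[of L] J L by (meson finite_subset subset_trans)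
      then have "(a, b) \<in> H \<inter> (\<Inter>i\<in>L. D i)"
        by (auto simp: D_def H_iff)
      then show ?thesis by blast
    qed
  qed (use J D in \<open>auto simp: D_def\<close>)
  have "H \<inter> (\<Inter>i\<in>I. D i) \<noteq> {}"
  proof (cases "I = {}")
    case True
    then show ?thesis using fin[of "{}"] by simp
  next
    case False
    then obtain i0 where i0: "i0 \<in> I" by blast
    \<comment> \<open>\<open>H\<close> itself is not compact, so one member \<open>D i0\<close>
      serves as the compact set for the finite intersection property.\<close>
    have "D i0 \<inter> (\<Inter>i\<in>I. D i) \<noteq> {}"
    proof (rule compact_imp_fip_image)
      show "D i0 \<inter> (\<Inter>i\<in>J. D i) \<noteq> {}" if "finite J" "J \<subseteq> I" for J
        using fin[of "insert i0 J"] that i0 by auto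
    qed (use D i0 compact_imp_closed in auto)
    moreover have "D i0 \<subseteq> H"
      by (auto simp: D_def)
    ultimately show ?thesis by blast
  qed
  then obtain a b where "(a, b) \<in> H" "\<forall>i\<in>I. (a, b) \<in> D i"
    by auto
  then show ?thesis
    by (auto simp: H_iff D_def)
qed

section \<open>Facet normals of a symmetric polytope\<close>

text \<open>A fixed-point-free involution splits \<open>A\<close> into pairs, and one element of
  each is kept. It will be applied to facets under negation.\<close>

lemma half_transversal:
  assumes "finite A" and "\<And>x. x \<in> A \<Longrightarrow> s x \<in> A" "\<And>x. x \<in> A \<Longrightarrow> s (s x) = x"
    "\<And>x. x \<in> A \<Longrightarrow> s x \<noteq> x"
  shows "\<exists>R\<subseteq>A. 2 * card R = card A \<and> (\<forall>x\<in>A. x \<in> R \<or> s x \<in> R)"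
  using assms
proof (induction A rule: finite_psubset_induct)
  case (psubset A)
  note s = psubset.prems
  show ?case
  proof (cases "A = {}")
    case False
    then obtain x where x: "x \<in> A" by blast
    define B where "B = A - {x, s x}"
    have "B \<subset> A" using x by (auto simp: B_def)
    moreover have "s y \<in> B" if "y \<in> B" for y
      using that s x unfolding B_def by (metis Diff_iff insert_iff singletonD singletonI)
    ultimately obtain R where R: "R \<subseteq> B" "2 * card R = card B" "\<forall>y\<in>B. y \<in> R \<or> s y \<in> R"
      using psubset.IH[of B] s by (metis psubsetD)
    have fR: "finite R"
      using R(1) psubset.hyps(1) by (auto simp: B_def intro: finite_subset)
    have "{x, s x} \<subseteq> A" "card {x, s x} = 2"
      using x s(1) s(3)[OF x] by (auto simp: card_2_iff)
    then have "card A = card B + 2"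
      using card_Diff_subset[of "{x, s x}" A] card_mono[of A "{x, s x}"] psubset.hyps(1)
      by (simp add: B_def)
    moreover have "x \<notin> R" using R(1) by (auto simp: B_def)
    ultimately have "2 * card (insert x R) = card A"
      using R(2) fR by simp
    moreover have "\<forall>y\<in>A. y \<in> insert x R \<or> s y \<in> insert x R"
      using R(3) s x by (auto simp: B_def)
    moreover have "insert x R \<subseteq> A"
      using x R(1) by (auto simp: B_def)
    ultimately show ?thesis by blast
  qed simp
qed

context
  fixes P :: "'a::euclidean_space set"
  assumes P: "polytope P" and int: "interior P \<noteq> {}" and sym: "\<forall>x\<in>P. - x \<in> P"
begin

lemmas norm_is_min =
  minkowski_norm_is_min[OF polytope_imp_compact[OF P] polytope_imp_convex[OF P] int sym]

lemma uminus_image_eq: "uminus ` P = P"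
proof
  show "P \<subseteq> uminus ` P"
  proof
    fix p assume "p \<in> P"
    then have "- (- p) \<in> uminus ` P"
      using sym by (intro imageI) blast
    then show "p \<in> uminus ` P" by simp
  qed
qed (use sym in blast)

lemma zero_in_interior: "0 \<in> interior P"
proof -
  obtain c where c: "c \<in> interior P"
    using int by blast
  then have "- c \<in> interior P"
    using interior_negations[of P] by (simp add: uminus_image_eq image_iff) (metis image_eqI)
  then have "(1/2) *\<^sub>R c + (1/2) *\<^sub>R (- c) \<in> interior P"
    using c polytope_imp_convex[OF P] by (intro convexD convex_interior) auto
  then show ?thesis by simp
qed

lemma facet_uminus:
  assumes "F facet_of P"
  shows "uminus ` F facet_of P"
proof -
  have l: "linear (uminus :: 'a \<Rightarrow> 'a)" "inj (uminus :: 'a \<Rightarrow> 'a)"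
    by (auto simp: linear_uminus)
  have "uminus ` F face_of P"
    using face_of_linear_image[OF l, of F P] assms
    by (simp add: uminus_image_eq facet_of_def)
  then show ?thesis
    using assms aff_dim_injective_linear_image[OF l, of F] by (simp add: facet_of_def)
qed

text \<open>Faces of a polytope are exposed. Since \<open>0\<close> is interior, it lies strictly
  inside the supporting half-space, so the offset \<open>b\<close> is positive and can be scaled to
  1.\<close>

lemma facet_normal:
  assumes F: "F facet_of P"
  obtains u where "\<And>p. p \<in> P \<Longrightarrow> u \<bullet> p \<le> 1" "\<And>p. p \<in> F \<Longrightarrow> u \<bullet> p = 1"
proof -
  have face: "F face_of P" "F \<noteq> P"
    using F by (auto simp: facet_of_def)
  then have "0 \<notin> F"
    using face_of_disjoint_interior zero_in_interior by blast
  obtain a b where ab: "P \<subseteq> {x. a \<bullet> x \<le> b}" "F = P \<inter> {x. a \<bullet> x = b}"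
    using face(1) exposed_face_of_polyhedron[OF polytope_imp_polyhedron[OF P]]
    by (metis exposed_face_of_def)
  have "0 \<in> P"
    using zero_in_interior interior_subset by blast
  then have "b > 0"
    using ab \<open>0 \<notin> F\<close> by (cases "b = 0") force+
  then show ?thesis
    using ab by (intro that[of "a /\<^sub>R b"]) (auto simp: field_simps)
qed

text \<open>If \<open>p\<close> were interior, it could be stretched slightly within
  \<open>P\<close>, contradicting minimality of the norm. So \<open>p\<close> is on the boundary,
  which is the union of the facets.\<close>

lemma in_facet_if_norm_ge_1:
  assumes "minkowski_norm P v \<ge> 1"
  obtains F p where "F facet_of P" "p \<in> F" "v = minkowski_norm P v *\<^sub>R p"
proof -
  define t where "t = minkowski_norm P v"
  obtain p where p: "p \<in> P" "v = t *\<^sub>R p"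
    using norm_is_min(2)[of v] by (auto simp: t_def)
  have "p \<notin> interior P"
  proof
    assume "p \<in> interior P"
    moreover have "((\<lambda>s::real. s *\<^sub>R p) \<longlongrightarrow> 1 *\<^sub>R p) (at_right 1)"
      by (intro tendsto_intros)
    ultimately have "\<forall>\<^sub>F s in at_right 1. s *\<^sub>R p \<in> interior P"
      using topological_tendstoD open_interior by fastforce
    moreover have "\<forall>\<^sub>F s in at_right (1::real). 1 < s"
      by (simp add: eventually_at_right_less)
    ultimately have "\<forall>\<^sub>F s in at_right (1::real). 1 < s \<and> s *\<^sub>R p \<in> P"
      by eventually_elim (use interior_subset in auto)
    then obtain s where s: "1 < s" "s *\<^sub>R p \<in> P"
      using eventually_happens trivial_limit_at_right_real by blast
    then have "v = (t / s) *\<^sub>R (s *\<^sub>R p)"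
      using p by simp
    then have "t \<le> t / s"
      unfolding t_def using norm_is_min(1,3) s
      by (metis divide_nonneg_pos image_eqI less_trans zero_less_one)
    then show False
      using s(1) assms by (simp add: t_def field_simps)
  qed
  then have "p \<in> P - rel_interior P"
    using p(1) rel_interior_nonempty_interior[OF int] by simp
  then show ?thesis
    using rel_boundary_of_polyhedron[OF polytope_imp_polyhedron[OF P]] p(2) that
    by (auto simp: t_def)
qed

text \<open>One normal per pair of opposite facets suffices, since the absolute value accounts for
  the other facet; this halves the count.\<close>

lemma norm_ge_1_iff_normals:
  obtains U where "finite U" "2 * card U \<le> card {F. F facet_of P}" "0 \<notin> U"
    "\<And>v. minkowski_norm P v \<ge> 1 \<longleftrightarrow> (\<exists>u\<in>U. \<bar>u \<bullet> v\<bar> \<ge> 1)"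
proof -
  let ?A = "{F. F facet_of P}"
  have "\<exists>n. \<forall>F\<in>?A. (\<forall>p\<in>P. n F \<bullet> p \<le> 1) \<and> (\<forall>p\<in>F. n F \<bullet> p = 1)"
    by (rule bchoice) (metis facet_normal mem_Collect_eq)
  then obtain n where n: "\<And>F p. F facet_of P \<Longrightarrow> p \<in> P \<Longrightarrow> n F \<bullet> p \<le> 1"
      "\<And>F p. F facet_of P \<Longrightarrow> p \<in> F \<Longrightarrow> n F \<bullet> p = 1"
    by auto
  have finA: "finite ?A"
    using P by (rule finite_polytope_facets)
  have "\<exists>R\<subseteq>?A. 2 * card R = card ?A \<and> (\<forall>F\<in>?A. F \<in> R \<or> uminus ` F \<in> R)"
  proof (rule half_transversal[OF finA])
    fix F assume "F \<in> ?A"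
    then have F: "F facet_of P" by simp
    then show "uminus ` F \<in> ?A"
      by (simp add: facet_uminus)
    show "uminus ` uminus ` F = F"
      by (simp add: image_image)
    obtain p where "p \<in> F"
      using F by (auto simp: facet_of_def)
    show "uminus ` F \<noteq> F"
    proof
      assume "uminus ` F = F"
      then have "- p \<in> F" using \<open>p \<in> F\<close> by blast
      then show False
        using n(2)[OF F, of p] n(2)[OF F, of "- p"] \<open>p \<in> F\<close> by simp
    qed
  qed
  then obtain R where R: "R \<subseteq> ?A" "2 * card R = card ?A" "\<And>F. F \<in> ?A \<Longrightarrow> F \<in> R \<or> uminus ` F \<in> R"
    by blast
  have finR: "finite R"
    using R(1) finA by (rule finite_subset)
  show ?thesis
  proof (rule that[of "n ` R"])
    show "finite (n ` R)" using finR by simp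
    show "2 * card (n ` R) \<le> card ?A"
      using card_image_le[OF finR, of n] R(2) by linarith
    show "0 \<notin> n ` R"
    proof
      assume "0 \<in> n ` R"
      then obtain F where F: "F facet_of P" "n F = 0" using R(1) by auto
      then obtain p where "p \<in> F" by (auto simp: facet_of_def)
      then show False using n(2)[OF F(1)] F(2) by simp
    qed
    fix v
    show "minkowski_norm P v \<ge> 1 \<longleftrightarrow> (\<exists>u\<in>n ` R. \<bar>u \<bullet> v\<bar> \<ge> 1)"
    proof
      assume ge: "minkowski_norm P v \<ge> 1"
      then obtain F p where F: "F facet_of P" "p \<in> F" "v = minkowski_norm P v *\<^sub>R p"
        using in_facet_if_norm_ge_1 by blast
      have "\<exists>u\<in>n ` R. \<bar>u \<bullet> p\<bar> = 1"
      proof (cases "F \<in> R")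
      case True
      then show ?thesis
        using n(2)[OF F(1,2)] by (intro bexI[of _ "n F"]) auto
    next
      case False
      then have "uminus ` F \<in> R"
        using R(3) F(1) by auto
      \<comment> \<open>The normal chosen for the opposite facet is not assumed to be the negative
        of \<open>n F\<close>; only its value at \<open>- p\<close> is used.\<close>
      moreover from this have "n (uminus ` F) \<bullet> (- p) = 1"
        using R(1) F(2) by (intro n(2)) auto
      ultimately show ?thesis
        by (intro bexI[of _ "n (uminus ` F)"]) auto
    qed
      then obtain u where "u \<in> n ` R" "\<bar>u \<bullet> p\<bar> = 1" by blast
      moreover have "\<bar>u \<bullet> v\<bar> = minkowski_norm P v * \<bar>u \<bullet> p\<bar>"
        using ge by (subst F(3)) (simp add: abs_mult)
      ultimately show "\<exists>u\<in>n ` R. \<bar>u \<bullet> v\<bar> \<ge> 1"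
        using ge by (intro bexI[of _ u]) auto
    next
      assume "\<exists>u\<in>n ` R. \<bar>u \<bullet> v\<bar> \<ge> 1"
      then obtain F where F: "F facet_of P" "\<bar>n F \<bullet> v\<bar> \<ge> 1"
        using R(1) by auto
      obtain p where p: "p \<in> P" "v = minkowski_norm P v *\<^sub>R p"
        using norm_is_min(2)[of v] by auto
      have "\<bar>n F \<bullet> p\<bar> \<le> 1"
        using n(1)[OF F(1), of p] n(1)[OF F(1), of "- p"] p(1) sym by auto
      moreover have "\<bar>n F \<bullet> v\<bar> = minkowski_norm P v * \<bar>n F \<bullet> p\<bar>"
        using norm_is_min(1)[of v] by (subst p(2)) (simp add: abs_mult)
      ultimately show "minkowski_norm P v \<ge> 1"
        using F(2) norm_is_min(1)[of v] mult_left_mono[of "\<bar>n F \<bullet> p\<bar>" 1 "minkowski_norm P v"]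
        by linarith
    qed
  qed
qed

text \<open>This serves the case of empty \<open>K\<close>. A vector as long as a Euclidean bound
  \<open>B\<close> of \<open>P\<close> is in no \<open>t\<close>-multiple of \<open>P\<close> with 0
  \<le> t < 1.\<close>

lemma exists_norm_ge_1: "\<exists>v. minkowski_norm P v \<ge> 1"
proof -
  obtain B where B: "B > 0" "\<And>p. p \<in> P \<Longrightarrow> norm p \<le> B"
    using polytope_imp_bounded[OF P] bounded_pos by metis
  obtain v :: 'a where v: "norm v = B"
    using B(1) vector_choose_size[of B] by auto
  obtain p where p: "p \<in> P" "v = minkowski_norm P v *\<^sub>R p"
    using norm_is_min(2)[of v] by auto
  have "B = minkowski_norm P v * norm p"
    using v norm_is_min(1)[of v] arg_cong[OF p(2), of norm] by simp
  also have "\<dots> \<le> minkowski_norm P v * B"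
    using B(2)[OF p(1)] norm_is_min(1) by (rule mult_left_mono)
  finally show ?thesis
    using B(1) by auto
qed

end

section \<open>Unit-width segments and the count of kd points\<close>

lemma segment_of_unit_width:
  fixes u :: "'a::real_inner"
  assumes "\<bar>u \<bullet> (b - a)\<bar> \<ge> 1"
  obtains a' b' where "a' \<in> closed_segment a b" "b' \<in> closed_segment a b" "u \<bullet> (b' - a') = 1"
proof -
  define s where "s = u \<bullet> (b - a)"
  \<comment> \<open>Cutting at the fraction \<open>1 / \<bar>s\<bar>\<close> turns width at least 1
    into width exactly 1, as the hyperplane \<open>H\<close> demands; the sign of \<open>s\<close>
    decides the orientation.\<close>
  define c where "c = a + (1 / \<bar>s\<bar>) *\<^sub>R (b - a)"
  have s: "\<bar>s\<bar> \<ge> 1" using assms by (simp add: s_def)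
  then have "1 / \<bar>s\<bar> \<le> 1" by (simp add: divide_simps)
  then have c: "c \<in> closed_segment a b"
    by (auto simp: c_def closed_segment_def algebra_simps intro!: exI[of _ "1 / \<bar>s\<bar>"])
  have uc: "u \<bullet> (c - a) = s / \<bar>s\<bar>"
    by (simp add: c_def s_def)
  show ?thesis
  proof (cases "s > 0")
    case True
    then show ?thesis using that[of a c] c uc by simp
  next
    case False
    then have "u \<bullet> (a - c) = 1"
      using uc s by (simp add: inner_diff_right)
    then show ?thesis using that[of c a] c by simp
  qed
qed

theorem theorem3p12:
  fixes P K :: "'a::euclidean_space set" and k :: nat
  assumes "polytope P"
    and "interior P \<noteq> {}"
    and "\<forall>x\<in>P. - x \<in> P"
    and "card {F. F facet_of P} = k"
    and "compact K"
    and "\<forall>x :: nat \<Rightarrow> 'a. (\<forall>i < k * DIM('a). x i \<in> K) \<longrightarrow>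
           (\<exists>a b. minkowski_norm P (b - a) \<ge> 1 \<and>
              (\<forall>z \<in> closed_segment a b. \<forall>i < k * DIM('a). sees K z (x i)))"
  shows "\<exists>a b. minkowski_norm P (b - a) \<ge> 1 \<and>
           (\<forall>z \<in> closed_segment a b. \<forall>y \<in> K. sees K z y)"
proof (cases "K = {}")
  case True
  obtain v where "minkowski_norm P v \<ge> 1"
    using exists_norm_ge_1[OF assms(1-3)] by blast
  then have "minkowski_norm P (v - 0) \<ge> 1"
    by simp
  then show ?thesis using True by blast
next
  case False
  define C where "C = (\<lambda>x. convex hull {z. sees K z x})"
  have C: "compact (C x)" "convex (C x)" for x
    by (simp_all add: C_def compact_convex_hull compact_sees assms(5))
  obtain U where U: "finite U" "2 * card U \<le> k" "0 \<notin> U"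
      and norm_iff: "\<And>v. minkowski_norm P v \<ge> 1 \<longleftrightarrow> (\<exists>u\<in>U. \<bar>u \<bullet> v\<bar> \<ge> 1)"
    using norm_ge_1_iff_normals[OF assms(1-3)] assms(4) by metis
  have "\<exists>u\<in>U. \<exists>a b. (\<forall>x\<in>K. a \<in> C x \<and> b \<in> C x) \<and> u \<bullet> (b - a) = 1"
  proof (rule ccontr)
    assume none: "\<not> ?thesis"
    have "\<exists>J. J \<subseteq> K \<and> finite J \<and> card J \<le> 2 * DIM('a) \<and>
        \<not> (\<exists>a b. (\<forall>x\<in>J. a \<in> C x \<and> b \<in> C x) \<and> u \<bullet> (b - a) = 1)" if "u \<in> U" for u
    proof (rule ccontr)
      assume no_J: "\<not> ?thesis"
      have "\<exists>a b. (\<forall>x\<in>K. a \<in> C x \<and> b \<in> C x) \<and> u \<bullet> (b - a) = 1"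
        by (rule Helly_width) (use C U(3) that no_J in auto)
      then show False using none that by blast
    qed
    then obtain J where J: "\<And>u. u \<in> U \<Longrightarrow> J u \<subseteq> K" "\<And>u. u \<in> U \<Longrightarrow> finite (J u)"
        "\<And>u. u \<in> U \<Longrightarrow> card (J u) \<le> 2 * DIM('a)"
        "\<And>u a b. u \<in> U \<Longrightarrow> \<forall>x\<in>J u. a \<in> C x \<and> b \<in> C x \<Longrightarrow> u \<bullet> (b - a) \<noteq> 1"
      by metis
    define X where "X = (\<Union>u\<in>U. J u)"
    have X: "finite X" "X \<subseteq> K"
      using J U(1) by (auto simp: X_def)
    have "card X \<le> (\<Sum>u\<in>U. card (J u))"
      unfolding X_def by (rule card_UN_le[OF U(1)])
    also have "\<dots> \<le> card U * (2 * DIM('a))"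
      using J(3) sum_bounded_above[of U "\<lambda>u. card (J u)" "2 * DIM('a)"] by simp
    also have "\<dots> \<le> k * DIM('a)"
      using U(2) mult_right_mono[of "2 * card U" k "DIM('a)"] by (simp add: algebra_simps)
    finally have cardX: "card X \<le> k * DIM('a)" .
    obtain y where y: "y \<in> K" using False by blast
    obtain f where f: "bij_betw f {..<card X} X"
      using ex_bij_betw_nat_finite[OF X(1)] by (auto simp: atLeast0LessThan)
    \<comment> \<open>The hypothesis takes exactly \<open>k * DIM('a)\<close> points, repetitions
      allowed, so the enumeration of \<open>X\<close> is padded with an arbitrary \<open>y\<close>
      in \<open>K\<close>.\<close>
    define x where "x = (\<lambda>i. if i < card X then f i else y)"
    have "\<forall>i < k * DIM('a). x i \<in> K"
      using f X(2) y by (auto simp: x_def bij_betw_def)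
    then obtain a b where ab: "minkowski_norm P (b - a) \<ge> 1"
        "\<forall>z \<in> closed_segment a b. \<forall>i < k * DIM('a). sees K z (x i)"
      using assms(6) by blast
    have inC: "z \<in> C w" if "z \<in> closed_segment a b" "w \<in> X" for z w
    proof -
      obtain i where "i < card X" "w = f i"
        using f \<open>w \<in> X\<close> by (auto simp: bij_betw_def)
      then have "sees K z w"
        using bspec[OF ab(2) that(1), rule_format, of i] cardX by (simp add: x_def)
      then show ?thesis
        by (auto simp: C_def intro: hull_inc)
    qed
    \<comment> \<open>The segment lies in every hull indexed by \<open>X\<close>, in particular by
      \<open>J u\<close>, so its width along this \<open>u\<close> contradicts the choice of
      \<open>J u\<close>.\<close>
    obtain u where u: "u \<in> U" "\<bar>u \<bullet> (b - a)\<bar> \<ge> 1"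
      using ab(1) norm_iff by blast
    obtain a' b' where "a' \<in> closed_segment a b" "b' \<in> closed_segment a b" "u \<bullet> (b' - a') = 1"
      using segment_of_unit_width[OF u(2)] .
    then show False
      using J(4)[OF u(1), of a' b'] inC u(1) by (auto simp: X_def)
  qed
  then obtain u a b where u: "u \<in> U" "u \<bullet> (b - a) = 1"
      and ab: "\<And>x. x \<in> K \<Longrightarrow> a \<in> C x \<and> b \<in> C x"
    by blast
  have "sees K z y" if "z \<in> closed_segment a b" "y \<in> K" for z y
  proof (rule sees_if_in_all_hulls[OF assms(5) that(2)])
    fix w assume "w \<in> K"
    then have "closed_segment a b \<subseteq> C w"
      using ab C(2) by (simp add: closed_segment_subset)
    then show "z \<in> convex hull {z. sees K z w}"
      using that(1) by (auto simp: C_def)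
  qed
  moreover have "minkowski_norm P (b - a) \<ge> 1"
    using norm_iff u by force
  ultimately show ?thesis by blast
qed

end
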